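(* Let $X$ be a finite-dimensional vector space over $K=\mathbb{F}_2$ equipped with a (possibly degenerate) alternating bilinear form $\omega$. Let $S$ be a basis of $X$ not of orthogonal type, and suppose $G(S)$ is connected. Let $G=(V,E)$ be a connected multigraph whose line graph is $G(S)$, with $E$ identified with $S$, and let $\delta:\langle V\rangle\to X^\ast$ and $d:\langle V\rangle\to\mathbb{Z}_{\ge 0}$ be the associated co-boundary map and function defined in the context. Then two elements $\beta,\gamma\in X^\ast$ belong to the same orbit of $\Gamma_S^\ast$ if and only if $\gamma-\beta\in\operatorname{im}\omega$ and either (i) $\beta\notin\operatorname{im}\delta$, or (ii) $\beta\in\operatorname{im}\delta$ and $d(y)=d(z)$ for some (or, equivalently, any) $y,z\in\langle V\rangle$ such that $\delta(y)=\beta$ and $\delta(z)=\gamma$.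
   Context: The form $\omega$ also denotes the linear map $\omega:X\to X^\ast$, $\omega(x)(y)=\omega(x,y)$. For $s\in X$ let $T_s(x)=x+\omega(x,s)s$. $\Gamma_S\le\mathrm{GL}(X)$ is generated by all $T_s$, $s\in S$; for $g\in\mathrm{GL}(X)$, $g^\ast(\alpha)=\alpha\circ g$, and $\Gamma_S^\ast=\{g^\ast:g\in\Gamma_S\}$ acts on $X^\ast$. $G(S)$ is the graph with vertex set $S$ and an edge between $u,v$ if $\omega(u,v)=1$. Orthogonal type: given a basis $S$ of $X$ and $s,t\in S$ with $\omega(s,t)=1$, replacing $t$ by $s+t$ gives another basis; bases related by a sequence of such replacements are t-equivalent. $S$ is of orthogonal type if it is t-equivalent to a basis $S'$ such that $G(S')$ is a tree containing $E_6$ as an induced subgraph, where $E_6$ has vertices $v_1,\dots,v_6$ and edges $v_1v_2,v_2v_3,v_3v_4,v_4v_5,v_3v_6$. A multigraph may have multiple edges but no loops. The line graph of a multigraph $(V,E)$ is the simple graph with vertex set $E$ and an edge between $e_1$ and $e_2$ if they have exactly one endpoint in common. By a theorem of Cuypers, a connected graph is the line graph of some connected multigraph if and only if it is not of orthogonal type (a graph $G(S)$ being of orthogonal type when the basis $S$ is), so a multigraph $G$ as in the claim exists. $\langle V\rangle$ is the free vector space over $\mathbb{F}_2$ on $V$, with the symmetric bilinear form $\omega_{\langle V\rangle}$ for which $V$ is orthonormal ($\omega_{\langle V\rangle}(u,v)=1$ if $u=v$ and $0$ otherwise, for $u,v\in V$). The boundary map $\partial:X\to\langle V\rangle$ is the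 linear map sending each edge $e\in E=S$ to the sum of its two endpoints. The co-boundary map $\delta:\langle V\rangle\to X^\ast$ is $\delta(y)(x)=\omega_{\langle V\rangle}(y,\partial(x))$. For $y\in\langle V\rangle$, $d_0(y)$ and $d_1(y)$ are the numbers of zero and one coordinates of $y$ in the basis $V$, and $d(y)=\min\{d_0(y),d_1(y)\}$. *)

theory Defs
  imports Complex_Main "HOL-Library.Z2" "HOL-Library.Poly_Mapping" "HOL-Algebra.Generated_Groups"
begin

text \<open>
  The field with two elements is the type \<open>bit\<close>. The vector space \<open>X\<close> is a type \<open>'x\<close> with scalar
  multiplication \<open>scale\<close>; linear maps, independence and span are those of
  \<open>HOL.Vector_Spaces\<close>.
\<close>

section \<open>Forms, transvections and the groups they generate\<close>

definition is_basis :: "(bit \<Rightarrow> 'x::ab_group_add \<Rightarrow> 'x) \<Rightarrow> 'x set \<Rightarrow> bool" where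
  "is_basis scale S \<longleftrightarrow> \<not> module.dependent scale S \<and> module.span scale S = UNIV"

definition dual_space :: "(bit \<Rightarrow> 'x::ab_group_add \<Rightarrow> 'x) \<Rightarrow> ('x \<Rightarrow> bit) set" where
  "dual_space scale = {\<alpha>. Vector_Spaces.linear scale (*) \<alpha>}"

text \<open>A form is kept curried, so that \<open>\<omega> x\<close> is the functional \<open>\<omega>(x)\<close> and \<open>range \<omega>\<close> is the image
  of the induced map from \<open>X\<close> to its dual.\<close>

definition alternating_form ::
  "(bit \<Rightarrow> 'x::ab_group_add \<Rightarrow> 'x) \<Rightarrow> ('x \<Rightarrow> 'x \<Rightarrow> bit) \<Rightarrow> bool" where
  "alternating_form scale \<omega> \<longleftrightarrow>
     (\<forall>x. Vector_Spaces.linear scale (*) (\<lambda>y. \<omega> x y)) \<and>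
     (\<forall>y. Vector_Spaces.linear scale (*) (\<lambda>x. \<omega> x y)) \<and>
     (\<forall>x. \<omega> x x = 0)"

definition GL_group :: "(bit \<Rightarrow> 'x::ab_group_add \<Rightarrow> 'x) \<Rightarrow> ('x \<Rightarrow> 'x) monoid" where
  "GL_group scale =
     \<lparr>carrier = {g. Vector_Spaces.linear scale scale g \<and> bij g}, mult = (\<circ>), one = id\<rparr>"

definition transvection ::
  "(bit \<Rightarrow> 'x::ab_group_add \<Rightarrow> 'x) \<Rightarrow> ('x \<Rightarrow> 'x \<Rightarrow> bit) \<Rightarrow> 'x \<Rightarrow> 'x \<Rightarrow> 'x" where
  "transvection scale \<omega> s x = x + scale (\<omega> x s) s"

definition Gamma ::
  "(bit \<Rightarrow> 'x::ab_group_add \<Rightarrow> 'x) \<Rightarrow> ('x \<Rightarrow> 'x \<Rightarrow> bit) \<Rightarrow> 'x set \<Rightarrow> ('x \<Rightarrow> 'x) set" where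
  "Gamma scale \<omega> S = generate (GL_group scale) (transvection scale \<omega> ` S)"

definition pullback :: "('x \<Rightarrow> 'x) \<Rightarrow> ('x \<Rightarrow> bit) \<Rightarrow> ('x \<Rightarrow> bit)" where
  "pullback g \<alpha> = \<alpha> \<circ> g"

definition Gamma_dual ::
  "(bit \<Rightarrow> 'x::ab_group_add \<Rightarrow> 'x) \<Rightarrow> ('x \<Rightarrow> 'x \<Rightarrow> bit) \<Rightarrow> 'x set \<Rightarrow> (('x \<Rightarrow> bit) \<Rightarrow> ('x \<Rightarrow> bit)) set"
  where "Gamma_dual scale \<omega> S = pullback ` Gamma scale \<omega> S"

definition Gamma_dual_orbit ::
  "(bit \<Rightarrow> 'x::ab_group_add \<Rightarrow> 'x) \<Rightarrow> ('x \<Rightarrow> 'x \<Rightarrow> bit) \<Rightarrow> 'x set \<Rightarrow> ('x \<Rightarrow> bit) \<Rightarrow> ('x \<Rightarrow> bit) set"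
  where "Gamma_dual_orbit scale \<omega> S \<beta> = {h \<beta> | h. h \<in> Gamma_dual scale \<omega> S}"


section \<open>Simple graphs and orthogonal type\<close>

text \<open>An edge of a simple graph is the two-element set of its endpoints.\<close>

record 'a sgraph =
  sverts :: "'a set"
  sedges :: "'a set set"

definition connected_graph :: "'a sgraph \<Rightarrow> bool" where
  "connected_graph H \<longleftrightarrow>
     (\<forall>u\<in>sverts H. \<forall>v\<in>sverts H.
        (u, v) \<in> {(a, b). a \<in> sverts H \<and> b \<in> sverts H \<and> {a, b} \<in> sedges H}\<^sup>*)"

definition is_cycle :: "'a sgraph \<Rightarrow> 'a list \<Rightarrow> bool" where
  "is_cycle H p \<longleftrightarrow>
     3 \<le> length p \<and> distinct p \<and> set p \<subseteq> sverts H \<and>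
     (\<forall>i<length p. {p ! i, p ! (Suc i mod length p)} \<in> sedges H)"

definition is_tree :: "'a sgraph \<Rightarrow> bool" where
  "is_tree H \<longleftrightarrow> sverts H \<noteq> {} \<and> connected_graph H \<and> (\<nexists>p. is_cycle H p)"

definition has_induced_subgraph :: "'a sgraph \<Rightarrow> 'b sgraph \<Rightarrow> bool" where
  "has_induced_subgraph H F \<longleftrightarrow>
     (\<exists>f. inj_on f (sverts F) \<and> f ` sverts F \<subseteq> sverts H \<and>
        (\<forall>u\<in>sverts F. \<forall>v\<in>sverts F. {f u, f v} \<in> sedges H \<longleftrightarrow> {u, v} \<in> sedges F))"

definition E6_graph :: "nat sgraph" where
  "E6_graph = \<lparr>sverts = {1, 2, 3, 4, 5, 6},
               sedges = {{1, 2}, {2, 3}, {3, 4}, {4, 5}, {3, 6}}\<rparr>"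

definition form_graph :: "('x \<Rightarrow> 'x \<Rightarrow> bit) \<Rightarrow> 'x set \<Rightarrow> 'x sgraph" where
  "form_graph \<omega> S =
     \<lparr>sverts = S, sedges = {{u, v} | u v. u \<in> S \<and> v \<in> S \<and> \<omega> u v = 1}\<rparr>"

definition t_step :: "('x::ab_group_add \<Rightarrow> 'x \<Rightarrow> bit) \<Rightarrow> 'x set \<Rightarrow> 'x set \<Rightarrow> bool" where
  "t_step \<omega> B B' \<longleftrightarrow>
     (\<exists>s\<in>B. \<exists>t\<in>B. \<omega> s t = 1 \<and> B' = insert (s + t) (B - {t}))"

text \<open>The reflexive transitive closure is already symmetric on bases: replacing \<open>t\<close> by \<open>s + t\<close> is
  undone by replacing \<open>s + t\<close> by \<open>s + (s + t) = t\<close>.\<close>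

definition t_equivalent :: "('x::ab_group_add \<Rightarrow> 'x \<Rightarrow> bit) \<Rightarrow> 'x set \<Rightarrow> 'x set \<Rightarrow> bool" where
  "t_equivalent \<omega> = (t_step \<omega>)\<^sup>*\<^sup>*"

definition orthogonal_type :: "('x::ab_group_add \<Rightarrow> 'x \<Rightarrow> bit) \<Rightarrow> 'x set \<Rightarrow> bool" where
  "orthogonal_type \<omega> S \<longleftrightarrow>
     (\<exists>S'. t_equivalent \<omega> S S' \<and> is_tree (form_graph \<omega> S') \<and>
           has_induced_subgraph (form_graph \<omega> S') E6_graph)"


section \<open>Multigraphs and line graphs\<close>

text \<open>Several edges may have the same set \<open>ends e\<close> of endpoints.\<close>

record ('v, 'e) multigraph =
  mverts :: "'v set"
  medges :: "'e set"
  ends :: "'e \<Rightarrow> 'v set"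

definition is_multigraph :: "('v, 'e) multigraph \<Rightarrow> bool" where
  "is_multigraph M \<longleftrightarrow> (\<forall>e\<in>medges M. ends M e \<subseteq> mverts M \<and> card (ends M e) = 2)"

definition connected_multigraph :: "('v, 'e) multigraph \<Rightarrow> bool" where
  "connected_multigraph M \<longleftrightarrow>
     connected_graph \<lparr>sverts = mverts M, sedges = ends M ` medges M\<rparr>"

definition line_graph :: "('v, 'e) multigraph \<Rightarrow> 'e sgraph" where
  "line_graph M =
     \<lparr>sverts = medges M,
      sedges = {{e, f} | e f. e \<in> medges M \<and> f \<in> medges M \<and> card (ends M e \<inter> ends M f) = 1}\<rparr>"


section \<open>The free space on the vertices, boundary and co-boundary\<close>

text \<open>Elements of the free space are finitely supported functions; the basis vector of
  a vertex \<open>v\<close> is \<open>Poly_Mapping.single v 1\<close>.\<close>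

definition free_space :: "'v set \<Rightarrow> ('v \<Rightarrow>\<^sub>0 bit) set" where
  "free_space V = {y. Poly_Mapping.keys y \<subseteq> V}"

definition free_scale :: "bit \<Rightarrow> ('v \<Rightarrow>\<^sub>0 bit) \<Rightarrow> ('v \<Rightarrow>\<^sub>0 bit)" where
  "free_scale c y = Poly_Mapping.map ((*) c) y"

definition free_form :: "('v \<Rightarrow>\<^sub>0 bit) \<Rightarrow> ('v \<Rightarrow>\<^sub>0 bit) \<Rightarrow> bit" where
  "free_form y z = (\<Sum>v\<in>Poly_Mapping.keys y. Poly_Mapping.lookup y v * Poly_Mapping.lookup z v)"

text \<open>\<open>vector_space_pair.construct\<close> extends a map linearly from a basis, here the set of edges.\<close>

definition boundary ::
  "(bit \<Rightarrow> 'x::ab_group_add \<Rightarrow> 'x) \<Rightarrow> ('v, 'x) multigraph \<Rightarrow> 'x \<Rightarrow> ('v \<Rightarrow>\<^sub>0 bit)" where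
  "boundary scale M =
     vector_space_pair.construct scale free_scale (medges M)
       (\<lambda>e. \<Sum>v\<in>ends M e. Poly_Mapping.single v 1)"

definition coboundary ::
  "(bit \<Rightarrow> 'x::ab_group_add \<Rightarrow> 'x) \<Rightarrow> ('v, 'x) multigraph \<Rightarrow> ('v \<Rightarrow>\<^sub>0 bit) \<Rightarrow> 'x \<Rightarrow> bit" where
  "coboundary scale M y = (\<lambda>x. free_form y (boundary scale M x))"

definition d_zero :: "'v set \<Rightarrow> ('v \<Rightarrow>\<^sub>0 bit) \<Rightarrow> nat" where
  "d_zero V y = card {v \<in> V. Poly_Mapping.lookup y v = 0}"

definition d_one :: "'v set \<Rightarrow> ('v \<Rightarrow>\<^sub>0 bit) \<Rightarrow> nat" where
  "d_one V y = card {v \<in> V. Poly_Mapping.lookup y v = 1}"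

definition d_min :: "'v set \<Rightarrow> ('v \<Rightarrow>\<^sub>0 bit) \<Rightarrow> nat" where
  "d_min V y = min (d_zero V y) (d_one V y)"


section \<open>Basic facts confirming the definitions\<close>

lemma lookup_free_scale:
  "Poly_Mapping.lookup (free_scale c y) v = c * Poly_Mapping.lookup y v"
  by (simp add: free_scale_def Poly_Mapping.map.rep_eq when_def)

lemma vector_space_free_scale: "vector_space free_scale"
  by unfold_locales
    (auto intro!: poly_mapping_eqI simp: lookup_free_scale lookup_add algebra_simps)

lemma free_form_single:
  "free_form (Poly_Mapping.single u 1) (Poly_Mapping.single v 1) = (if u = v then 1 else 0)"
  by (simp add: free_form_def lookup_single)

lemma free_form_eq_sum:
  assumes "finite A" "Poly_Mapping.keys y \<subseteq> A"
  shows "free_form y z = (\<Sum>v\<in>A. Poly_Mapping.lookup y v * Poly_Mapping.lookup z v)"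
  unfolding free_form_def using assms
  by (intro sum.mono_neutral_left) (auto simp: in_keys_iff)

lemma free_form_commute: "free_form y z = free_form z y"
proof -
  let ?A = "Poly_Mapping.keys y \<union> Poly_Mapping.keys z"
  have "free_form y z = (\<Sum>v\<in>?A. Poly_Mapping.lookup y v * Poly_Mapping.lookup z v)"
    by (rule free_form_eq_sum) auto
  moreover have "free_form z y = (\<Sum>v\<in>?A. Poly_Mapping.lookup z v * Poly_Mapping.lookup y v)"
    by (rule free_form_eq_sum) auto
  ultimately show ?thesis by (simp only: mult.commute)
qed

lemma free_form_linear: "Vector_Spaces.linear free_scale (*) (free_form y)"
proof -
  have "free_form y (z + w) = free_form y z + free_form y w" for z w
    by (simp only: free_form_def lookup_add distrib_left sum.distrib)
  moreover have "free_form y (free_scale c z) = c * free_form y z" for c z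
    by (simp only: free_form_def lookup_free_scale sum_distrib_left mult.left_commute)
  moreover have "vector_space ((*) :: bit \<Rightarrow> bit \<Rightarrow> bit)"
    by unfold_locales (simp_all only: distrib_left distrib_right mult.assoc mult_1_left)
  ultimately show ?thesis
    using vector_space_free_scale
    by (intro Vector_Spaces.linear.intro)
      (auto simp: module_hom_iff vector_space_def module_def)
qed

lemma boundary_linear:
  assumes "vector_space scale" "is_basis scale (medges M)"
  shows "Vector_Spaces.linear scale free_scale (boundary scale M)"
proof -
  interpret vector_space_pair scale free_scale
    using assms(1) vector_space_free_scale by (rule vector_space_pair.intro)
  show ?thesis
    using assms(2) unfolding boundary_def is_basis_def by (intro linear_construct) auto
qed

lemma boundary_edge:
  assumes "vector_space scale" "is_basis scale (medges M)" "e \<in> medges M"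
  shows "boundary scale M e = (\<Sum>v\<in>ends M e. Poly_Mapping.single v 1)"
proof -
  interpret vector_space_pair scale free_scale
    using assms(1) vector_space_free_scale by (rule vector_space_pair.intro)
  show ?thesis
    using assms(2,3) unfolding boundary_def is_basis_def by (intro construct_basis) auto
qed

lemma group_GL_group:
  assumes "vector_space scale"
  shows "group (GL_group scale)"
proof -
  interpret vector_space scale by fact
  interpret P: vector_space_pair scale scale by unfold_locales
  show ?thesis
  proof (rule groupI)
    fix g assume "g \<in> carrier (GL_group scale)"
    then have g: "Vector_Spaces.linear scale scale g" "bij g" by (auto simp: GL_group_def)
    then obtain h where h: "Vector_Spaces.linear scale scale h" "h \<circ> g = id"
      using P.linear_injective_left_inverse bij_is_inj by blast
    moreover from h g(2) have "bij h"
      by (metis bij_betw_comp_iff bij_id)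
    ultimately show "\<exists>h\<in>carrier (GL_group scale). h \<otimes>\<^bsub>GL_group scale\<^esub> g = \<one>\<^bsub>GL_group scale\<^esub>"
      by (auto simp: GL_group_def)
  qed (auto simp: GL_group_def bij_comp linear_id Vector_Spaces.linear_compose comp_assoc)
qed

lemma transvection_in_GL_group:
  assumes "vector_space scale" "alternating_form scale \<omega>"
  shows "transvection scale \<omega> s \<in> carrier (GL_group scale)"
proof -
  interpret vector_space scale by fact
  have lin: "module_hom scale (*) (\<lambda>x. \<omega> x z)" and alt: "\<omega> x x = 0" for x z
    using assms(2) unfolding alternating_form_def Vector_Spaces.linear_def by blast+
  note add = module_hom.add[OF lin] and scl = module_hom.scale[OF lin]
  have two: "scale a s + scale a s = 0" for a
    by (cases a) (simp_all flip: scale_left_distrib del: scale_one)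
  have "transvection scale \<omega> s (transvection scale \<omega> s x) = x" for x
    using two[of 1] by (simp add: transvection_def add scl alt add.assoc)
  then have "bij (transvection scale \<omega> s)"
    by (rule involuntory_imp_bij)
  moreover have "Vector_Spaces.linear scale scale (transvection scale \<omega> s)"
    using two[of 1] by unfold_locales (auto simp: transvection_def add scl algebra_simps)
  ultimately show ?thesis by (simp add: GL_group_def)
qed

end

theory Submission
  imports Defs
begin

text \<open>
  The boundary map \<open>\<partial>\<close> turns \<open>\<omega>\<close> into the standard form on the free space, so \<open>\<omega>(x) = \<delta>(\<partial>x)\<close>, and
  \<open>T\<^sub>s\<^sup>*\<close> sends \<open>\<alpha>\<close> to \<open>\<alpha> + \<alpha>(s) \<omega>(s)\<close>. If \<open>\<alpha> = \<delta>(y)\<close> and \<open>s\<close> joins \<open>u\<close> and \<open>v\<close>, this exchanges the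
  coordinates \<open>y\<^sub>u\<close> and \<open>y\<^sub>v\<close>. As the multigraph is connected, all coordinate permutations arise, and
  the kernel of \<open>\<delta>\<close> consists of 0 and the all-ones vector, whence the invariant \<open>d\<close>.

  The set of \<open>x\<close> with \<open>T\<^sub>x\<close> in the group contains \<open>x + y\<close> with \<open>x\<close> and \<open>y\<close> whenever \<open>\<omega>(x, y) = 1\<close>, so it
  contains elements with boundary \<open>u + v\<close> for any two vertices. If \<open>\<alpha>\<close> is not in the image of \<open>\<delta>\<close>,
  it takes the value 1 on some such element: otherwise \<open>\<alpha>\<close> has a potential. Hence \<open>\<alpha>\<close> can be
  moved to \<open>\<alpha> + \<omega>(s)\<close> for every \<open>s\<close> in the basis, and its orbit is the whole coset of the image
  of \<open>\<omega>\<close>.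
\<close>

section \<open>Coordinates and supports in the free space\<close>

abbreviation (input) "keys \<equiv> Poly_Mapping.keys"
abbreviation (input) "lookup \<equiv> Poly_Mapping.lookup"

lemma bit_cases: "(b::bit) = 0 \<or> b = 1"
  by (cases b) auto

lemma bit_add_self: "(b::bit) + b = 0"
  by (cases b) auto

lemma vector_space_bit: "vector_space ((*) :: bit \<Rightarrow> bit \<Rightarrow> bit)"
  by unfold_locales (simp_all only: distrib_left distrib_right mult.assoc mult_1_left)

lemma free_add_self: "(y :: 'v \<Rightarrow>\<^sub>0 bit) + y = 0"
  by (rule poly_mapping_eqI) (simp add: lookup_add bit_add_self)

lemma lookup_neq_0_bit: "lookup y v \<noteq> (0::bit) \<longleftrightarrow> lookup y v = 1"
  using bit_cases[of "lookup y v"] by auto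

lemma in_keys_bit_iff: "v \<in> keys y \<longleftrightarrow> lookup y v = (1::bit)"
  by (simp add: in_keys_iff lookup_neq_0_bit)

lemma lookup_sum_single:
  assumes "finite A"
  shows "lookup (\<Sum>v\<in>A. Poly_Mapping.single v (1::bit)) w = (if w \<in> A then 1 else 0)"
  using assms by (simp add: lookup_sum lookup_single when_def)

lemma free_form_add_left: "free_form (y + z) w = free_form y w + free_form z w"
proof -
  let ?A = "keys y \<union> keys z \<union> keys (y + z)"
  have "free_form u w = (\<Sum>v\<in>?A. lookup u v * lookup w v)" if "keys u \<subseteq> ?A" for u
    using that by (intro free_form_eq_sum) auto
  then have "free_form y w = (\<Sum>v\<in>?A. lookup y v * lookup w v)"
    "free_form z w = (\<Sum>v\<in>?A. lookup z v * lookup w v)"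
    "free_form (y + z) w = (\<Sum>v\<in>?A. lookup (y + z) v * lookup w v)"
    by blast+
  then show ?thesis
    by (simp only: lookup_add distrib_right sum.distrib)
qed

lemma free_form_sum_single:
  assumes "finite A"
  shows "free_form y (\<Sum>v\<in>A. Poly_Mapping.single v 1) = (\<Sum>v\<in>A. lookup y v)"
proof -
  have "free_form y (\<Sum>v\<in>A. Poly_Mapping.single v 1)
      = (\<Sum>v\<in>keys y \<union> A. lookup y v * lookup (\<Sum>v\<in>A. Poly_Mapping.single v 1) v)"
    using assms by (intro free_form_eq_sum) auto
  also have "\<dots> = (\<Sum>v\<in>A. lookup y v)"
    using assms by (intro sum.mono_neutral_cong_right) (auto simp: lookup_sum_single)
  finally show ?thesis .
qed

lemma free_form_pair:
  assumes "u \<noteq> v"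
  shows "free_form y (Poly_Mapping.single u 1 + Poly_Mapping.single v 1) = lookup y u + lookup y v"
  using free_form_sum_single[of "{u, v}" y] assms by simp

text \<open>Adding both basis vectors at unequal coordinates exchanges these, so the support loses
  one vertex and gains the other.\<close>

lemma card_keys_exchange:
  fixes y :: "'v \<Rightarrow>\<^sub>0 bit"
  assumes "lookup y u \<noteq> lookup y v"
  shows "card (keys (y + Poly_Mapping.single u 1 + Poly_Mapping.single v 1)) = card (keys y)"
proof -
  have main: "card (keys (y + Poly_Mapping.single a 1 + Poly_Mapping.single b 1)) = card (keys y)"
    if "lookup y a = 1" "lookup y b = 0" for a b
  proof -
    have "keys (y + Poly_Mapping.single a 1 + Poly_Mapping.single b 1) = insert b (keys y - {a})"
      using that
      by (auto simp: in_keys_bit_iff lookup_add lookup_single when_def bit_add_self split: if_splits)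
    moreover have "a \<in> keys y" "b \<notin> keys y"
      using that by (auto simp: in_keys_bit_iff)
    ultimately show ?thesis
      by (metis DiffE card_Suc_Diff1 card_insert_disjoint finite_Diff finite_keys)
  qed
  show ?thesis
    using assms bit_cases[of "lookup y u"] bit_cases[of "lookup y v"]
      main[of u v] main[of v u]
    by (auto simp: ac_simps)
qed

text \<open>The all-ones vector flips every coordinate on \<open>V\<close>, so the support turns
  into its complement.\<close>

lemma card_keys_add_ones:
  fixes y :: "'v \<Rightarrow>\<^sub>0 bit"
  assumes "finite V" "keys y \<subseteq> V"
  shows "card (keys (y + (\<Sum>v\<in>V. Poly_Mapping.single v 1)))
    = card V - card (keys y)"
proof -
  have "keys (y + (\<Sum>v\<in>V. Poly_Mapping.single v 1)) = V - keys y"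
  proof (rule Set.set_eqI)
    fix v
    show "v \<in> keys (y + (\<Sum>v\<in>V. Poly_Mapping.single v 1))
      \<longleftrightarrow> v \<in> V - keys y"
    proof (cases "v \<in> V")
      case True
      then show ?thesis
        using assms bit_cases[of "lookup y v"]
        by (auto simp: in_keys_bit_iff lookup_add lookup_sum_single)
    next
      case False
      moreover from this have "lookup y v = 0"
        using assms by (auto simp: in_keys_iff)
      ultimately show ?thesis
        using assms by (simp add: in_keys_bit_iff lookup_add lookup_sum_single)
    qed
  qed
  then show ?thesis
    using assms by (simp add: card_Diff_subset)
qed

text \<open>Lets the orbit arguments work with support sizes alone: over two elements the support is
  the set of ones.\<close>

lemma d_min_eq_card_keys:
  assumes "finite V" "keys y \<subseteq> V"
  shows "d_min V y = min (card V - card (keys y)) (card (keys y))"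
proof -
  have "{v \<in> V. lookup y v = 0} = V - keys y" "{v \<in> V. lookup y v = 1} = keys y"
    using assms by (auto simp: in_keys_iff in_keys_bit_iff)
  then show ?thesis
    using assms by (simp add: d_min_def d_zero_def d_one_def card_Diff_subset)
qed

lemma free_space_add: "y \<in> free_space V \<Longrightarrow> z \<in> free_space V \<Longrightarrow> y + z \<in> free_space V"
  using Poly_Mapping.keys_add[of y z] by (auto simp: free_space_def)

lemma single_in_free_space: "v \<in> V \<Longrightarrow> Poly_Mapping.single v 1 \<in> free_space V"
  by (simp add: free_space_def)

section \<open>Functionals and boundaries attached to a line graph\<close>

locale line_graph_form =
  fixes scale :: "bit \<Rightarrow> 'x::ab_group_add \<Rightarrow> 'x"
    and S :: "'x set"
    and \<omega> :: "'x \<Rightarrow> 'x \<Rightarrow> bit"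
    and M :: "('v, 'x) multigraph"
  assumes vector_space: "vector_space scale"
    and alternating: "alternating_form scale \<omega>"
    and basis: "is_basis scale S"
    and finite_basis: "finite S"
    and multigraph: "is_multigraph M"
    and connected: "connected_multigraph M"
    and line_graph: "line_graph M = form_graph \<omega> S"
begin

sublocale vector_space scale by (rule vector_space)

abbreviation "V \<equiv> mverts M"
abbreviation "bd \<equiv> boundary scale M"
abbreviation "\<delta> \<equiv> coboundary scale M"
abbreviation "T \<equiv> transvection scale \<omega>"
abbreviation "\<Gamma> \<equiv> Gamma scale \<omega> S"
abbreviation "orbit \<equiv> Gamma_dual_orbit scale \<omega> S"
abbreviation "vtx v \<equiv> Poly_Mapping.single v (1::bit)"

lemma add_self: "(x :: 'x) + x = 0"
  by (metis bit_add_self scale_left_distrib scale_one scale_zero_left)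

lemma medges_eq: "medges M = S"
  using arg_cong[OF line_graph, of sverts] by (simp add: line_graph_def form_graph_def)

lemma span_S: "x \<in> span S"
  using basis by (simp add: is_basis_def)

lemma omega_linear_left: "Vector_Spaces.linear scale (*) (\<lambda>x. \<omega> x y)"
  using alternating unfolding alternating_form_def by blast

lemma omega_linear_right: "Vector_Spaces.linear scale (*) (\<omega> x)"
  using alternating unfolding alternating_form_def by auto

lemma omega_self [simp]: "\<omega> x x = 0"
  using alternating unfolding alternating_form_def by blast

lemma
  assumes "Vector_Spaces.linear scale (*) \<alpha>"
  shows dual_add: "\<alpha> (x + y) = \<alpha> x + \<alpha> y" and dual_scale: "\<alpha> (scale c x) = c * \<alpha> x"
    and dual_zero: "\<alpha> 0 = 0"
  using assms by (auto simp: Vector_Spaces.linear_def module_hom.add module_hom.scale module_hom.zero)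

lemma dual_eqI:
  assumes "Vector_Spaces.linear scale (*) \<alpha>" "Vector_Spaces.linear scale (*) \<beta>"
    and "\<And>e. e \<in> S \<Longrightarrow> \<alpha> e = \<beta> e"
  shows "\<alpha> = \<beta>"
proof
  fix x
  interpret P: vector_space_pair scale "(*) :: bit \<Rightarrow> bit \<Rightarrow> bit"
    using vector_space vector_space_bit by (rule vector_space_pair.intro)
  show "\<alpha> x = \<beta> x"
    using assms span_S by (intro P.linear_eq_on_span[of \<alpha> \<beta> S x]) auto
qed

lemmas omega_simps = dual_add[OF omega_linear_left] dual_add[OF omega_linear_right]
  dual_scale[OF omega_linear_left] dual_scale[OF omega_linear_right]
  dual_zero[OF omega_linear_left] dual_zero[OF omega_linear_right]

lemma omega_commute: "\<omega> x y = \<omega> y x"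
proof -
  have "\<omega> x y + \<omega> y x = 0"
    using omega_self[of "x + y"] by (simp add: omega_simps del: omega_self) (simp add: add.commute)
  then show ?thesis
    using bit_cases[of "\<omega> x y"] bit_cases[of "\<omega> y x"] by auto
qed

lemma boundary_add: "bd (x + y) = bd x + bd y"
  and boundary_scale: "bd (scale c x) = free_scale c (bd x)"
  and boundary_zero: "bd 0 = 0"
  using boundary_linear[OF vector_space, of M] basis medges_eq
  by (auto simp: Vector_Spaces.linear_def module_hom.add module_hom.scale module_hom.zero)

lemma boundary_S: "e \<in> S \<Longrightarrow> bd e = (\<Sum>v\<in>ends M e. vtx v)"
  using boundary_edge[OF vector_space] basis medges_eq by metis

lemma ends_pair:
  assumes "e \<in> S"
  obtains u v where "ends M e = {u, v}" "u \<noteq> v" "u \<in> V" "v \<in> V" "bd e = vtx u + vtx v"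
proof -
  have "card (ends M e) = 2" "ends M e \<subseteq> V"
    using assms multigraph medges_eq by (auto simp: is_multigraph_def)
  then obtain u v where "ends M e = {u, v}" "u \<noteq> v" "u \<in> V" "v \<in> V"
    by (auto simp: card_2_iff)
  with that boundary_S[OF assms] show thesis by auto
qed

lemma boundary_in_free_space: "bd x \<in> free_space V"
  using span_S
proof (induction x rule: span_induct_alt)
  case base
  then show ?case by (simp add: boundary_zero free_space_def)
next
  case (step c e x)
  obtain u v where "u \<in> V" "v \<in> V" "bd e = vtx u + vtx v"
    using ends_pair[OF step(1)] by metis
  then have "bd e \<in> free_space V"
    by (metis free_space_add single_in_free_space)
  then have "free_scale c (bd e) \<in> free_space V"
    by (auto simp: free_space_def in_keys_iff lookup_free_scale)
  then show ?case
    using step by (simp add: boundary_add boundary_scale free_space_add)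
qed

lemma coboundary_linear: "Vector_Spaces.linear scale (*) (\<delta> y)"
proof -
  have "\<delta> y = free_form y \<circ> bd"
    by (auto simp: coboundary_def)
  then show ?thesis
    using boundary_linear[OF vector_space, of M] basis medges_eq free_form_linear[of y]
    by (auto intro: Vector_Spaces.linear_compose)
qed

lemma coboundary_add: "\<delta> (y + z) x = \<delta> y x + \<delta> z x"
  by (simp add: coboundary_def free_form_add_left)

lemma coboundary_apply: "u \<noteq> v \<Longrightarrow> bd x = vtx u + vtx v \<Longrightarrow> \<delta> y x = lookup y u + lookup y v"
  by (simp add: coboundary_def free_form_pair)

section \<open>The form in terms of endpoints\<close>

lemma omega_eq_1_iff:
  assumes "e \<in> S" "f \<in> S"
  shows "\<omega> e f = 1 \<longleftrightarrow> card (ends M e \<inter> ends M f) = 1"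
proof -
  have "\<omega> e f = 1 \<longleftrightarrow> {e, f} \<in> sedges (form_graph \<omega> S)"
    using assms omega_commute by (auto simp: form_graph_def doubleton_eq_iff)
  also have "\<dots> \<longleftrightarrow> {e, f} \<in> sedges (line_graph M)"
    by (simp add: line_graph)
  also have "\<dots> \<longleftrightarrow> card (ends M e \<inter> ends M f) = 1"
    using assms by (auto simp: line_graph_def medges_eq doubleton_eq_iff Int_commute)
  finally show ?thesis .
qed

text \<open>The form is the pullback of the standard form along the boundary map; in particular
  parallel edges are orthogonal because they share two endpoints.\<close>

lemma omega_eq_coboundary: "\<omega> x = \<delta> (bd x)"
proof -
  have edges: "\<omega> e f = \<delta> (bd e) f" if ef: "e \<in> S" "f \<in> S" for e f
  proof -
    obtain a b where ab: "ends M e = {a, b}" "a \<noteq> b" "bd e = vtx a + vtx b"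
      using ends_pair[OF ef(1)] by metis
    obtain c d where cd: "ends M f = {c, d}" "c \<noteq> d" "bd f = vtx c + vtx d"
      using ends_pair[OF ef(2)] by metis
    \<comment> \<open>The left side counts shared endpoints modulo 2, so none and two both give
      0.\<close>
    have "\<delta> (bd e) f = 1 \<longleftrightarrow> card ({a, b} \<inter> {c, d}) = 1"
      using ab cd by (auto simp: coboundary_apply lookup_add lookup_single when_def)
    then show ?thesis
      using omega_eq_1_iff[OF ef] ab cd bit_cases[of "\<omega> e f"] bit_cases[of "\<delta> (bd e) f"]
      by auto
  qed
  have "\<omega> e = \<delta> (bd e)" if "e \<in> S" for e
    using edges that by (intro dual_eqI omega_linear_right coboundary_linear)
  \<comment> \<open>The pullback is symmetric like \<open>\<omega>\<close>, so equality on pairs of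
    edges extends linearly first in one argument, then in the other.\<close>
  moreover have "\<delta> (bd y) z = \<delta> (bd z) y" for y z
    by (simp add: coboundary_def free_form_commute)
  ultimately have "\<omega> x e = \<delta> (bd x) e" if "e \<in> S" for e
    using that by (metis omega_commute)
  then show ?thesis
    by (intro dual_eqI omega_linear_right coboundary_linear)
qed

section \<open>Connectedness and the kernel of the co-boundary\<close>

text \<open>Propagates a property along a path of edges; in this form the connectedness of
  \<open>M\<close> enters the later arguments.\<close>

lemma vertex_induct [consumes 2, case_names base step]:
  assumes "u \<in> V" "v \<in> V"
    and "P u"
    and "\<And>e w w'. e \<in> S \<Longrightarrow> ends M e = {w, w'} \<Longrightarrow> w \<in> V \<Longrightarrow> w' \<in> V \<Longrightarrow> P w \<Longrightarrow> P w'"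
  shows "P v"
proof -
  have "(u, v) \<in> {(a, b). a \<in> V \<and> b \<in> V \<and> {a, b} \<in> ends M ` medges M}\<^sup>*"
    using connected assms(1,2) by (auto simp: connected_multigraph_def connected_graph_def)
  then show ?thesis
  proof (induction rule: rtrancl_induct)
    case base
    show ?case by fact
  next
    case (step w w')
    then obtain e where "e \<in> S" "ends M e = {w, w'}" "w \<in> V" "w' \<in> V"
      by (auto simp: medges_eq)
    with step.IH assms(4) show ?case by blast
  qed
qed

text \<open>A path from a fixed \<open>u\<close> to another vertex ends with an edge, so
  \<open>u\<close> and the endpoints of the finitely many edges exhaust \<open>V\<close>.\<close>

lemma finite_verts: "finite V"
proof (cases "V = {}")
  case False
  then obtain u where u: "u \<in> V" by blast
  have "v \<in> insert u (\<Union>e\<in>S. ends M e)" if "v \<in> V" for v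
    using u that by (induction rule: vertex_induct) auto
  moreover have "finite (ends M e)" if "e \<in> S" for e
    using ends_pair[OF that] by (metis finite.emptyI finite.insertI)
  ultimately show ?thesis
    using finite_basis by (intro finite_subset[of V "insert u (\<Union>e\<in>S. ends M e)"]) auto
qed simp

abbreviation "ones \<equiv> (\<Sum>v\<in>V. vtx v)"

lemma ones_in_free_space: "ones \<in> free_space V"
  using finite_verts by (auto simp: free_space_def in_keys_iff lookup_sum_single split: if_splits)

lemma coboundary_ones: "\<delta> ones x = 0"
proof -
  have "\<delta> ones = (\<lambda>x. 0)"
  proof (rule dual_eqI[OF coboundary_linear])
    show "Vector_Spaces.linear scale (*) (\<lambda>x. 0::bit)"
      using vector_space vector_space_bit
      by (intro Vector_Spaces.linear.intro) (auto simp: module_hom_iff vector_space_def module_def)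
    fix e assume "e \<in> S"
    then obtain u v where "u \<noteq> v" "u \<in> V" "v \<in> V" "bd e = vtx u + vtx v"
      using ends_pair by metis
    then show "\<delta> ones e = 0"
      using finite_verts by (simp add: coboundary_apply lookup_sum_single)
  qed
  then show ?thesis by simp
qed

text \<open>Vanishing on an edge forces equal coordinates at its two ends; connectedness then makes
  \<open>y\<close> constant on \<open>V\<close>.\<close>

lemma coboundary_kernel:
  assumes "y \<in> free_space V" "\<And>x. \<delta> y x = 0"
  shows "y = 0 \<or> y = ones"
proof -
  have const: "lookup y v = lookup y u" if "u \<in> V" "v \<in> V" for u v
    using that
  proof (induction rule: vertex_induct)
    case (step e w w')
    obtain a b where "ends M e = {a, b}" "a \<noteq> b" "bd e = vtx a + vtx b"
      using ends_pair[OF step(1)] by metis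
    moreover from this have "lookup y a + lookup y b = 0"
      using assms(2)[of e] by (simp add: coboundary_apply)
    ultimately show ?case
      using step bit_cases[of "lookup y a"] bit_cases[of "lookup y b"]
      by (auto simp: doubleton_eq_iff)
  qed simp
  have outside: "lookup y v = 0" if "v \<notin> V" for v
    using assms(1) that by (auto simp: free_space_def in_keys_iff)
  show ?thesis
  proof (cases "\<exists>u\<in>V. lookup y u = 1")
    case True
    then obtain u where "u \<in> V" "lookup y u = 1" by blast
    then have "lookup y v = 1" if "v \<in> V" for v
      using const that by metis
    then have "y = ones"
      using outside finite_verts by (intro poly_mapping_eqI) (auto simp: lookup_sum_single)
    then show ?thesis ..
  next
    case False
    then have "y = 0"
      using outside by (intro poly_mapping_eqI) (metis False lookup_zero lookup_neq_0_bit)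
    then show ?thesis ..
  qed
qed

text \<open>In characteristic 2 the difference of \<open>y\<close> and \<open>z\<close> is
  \<open>y + z\<close>, which lies in the kernel of \<open>\<delta>\<close>.\<close>

lemma coboundary_eqD:
  assumes "y \<in> free_space V" "z \<in> free_space V" "\<delta> y = \<delta> z"
  shows "z = y \<or> z = y + ones"
proof -
  have "y + z = 0 \<or> y + z = ones"
    using assms
    by (intro coboundary_kernel) (simp_all add: free_space_add coboundary_add bit_add_self)
  then have "y + (y + z) = y \<or> y + (y + z) = y + ones"
    by (elim disjE) simp_all
  then show ?thesis
    by (simp only: add.assoc[symmetric] free_add_self add_0_left)
qed

lemma d_min_complement: "y \<in> free_space V \<Longrightarrow> d_min V (y + ones) = d_min V y"
proof -
  assume y: "y \<in> free_space V"
  \<comment> \<open>With this bound, truncated subtraction from \<open>card V\<close> is an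
    involution, so complementing only swaps the arguments of \<open>min\<close>.\<close>
  then have "card (keys y) \<le> card V"
    using finite_verts by (auto simp: free_space_def intro: card_mono)
  then show ?thesis
    using y free_space_add[OF y ones_in_free_space] finite_verts
    by (auto simp: free_space_def d_min_eq_card_keys card_keys_add_ones min_def)
qed

text \<open>Makes \<open>d_min\<close> well defined on the image of \<open>\<delta>\<close>,
  whatever preimage is chosen.\<close>

lemma d_min_eq_of_coboundary_eq:
  "y \<in> free_space V \<Longrightarrow> z \<in> free_space V \<Longrightarrow> \<delta> y = \<delta> z \<Longrightarrow> d_min V y = d_min V z"
  using coboundary_eqD d_min_complement by metis

section \<open>The group \<open>\<Gamma>\<close> and its action on functionals\<close>

lemma transvection_invol: "T s (T s x) = x"
  by (simp add: transvection_def omega_simps add.assoc add_self)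

lemma Gamma_comp: "g \<in> \<Gamma> \<Longrightarrow> h \<in> \<Gamma> \<Longrightarrow> g \<circ> h \<in> \<Gamma>"
  using generate.eng[of g "GL_group scale" _ h] by (simp add: Gamma_def GL_group_def)

lemma id_in_Gamma: "id \<in> \<Gamma>"
  using generate.one[of "GL_group scale"] by (simp add: Gamma_def GL_group_def id_def)

lemma transvection_in_Gamma: "s \<in> S \<Longrightarrow> T s \<in> \<Gamma>"
  by (simp add: Gamma_def generate.incl)

text \<open>Transvections are involutions, so inverses of generators are generators and need no case
  of their own.\<close>

lemma Gamma_induct [consumes 1, case_names id transvection comp]:
  assumes "g \<in> \<Gamma>" "P id" "\<And>s. s \<in> S \<Longrightarrow> P (T s)" "\<And>g h. P g \<Longrightarrow> P h \<Longrightarrow> P (g \<circ> h)"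
  shows "P g"
  using assms(1) unfolding Gamma_def
proof (induction rule: generate.induct)
  case one
  then show ?case using assms(2) by (simp add: GL_group_def id_def)
next
  case (incl h)
  then show ?case using assms(3) by auto
next
  case (inv h)
  then obtain s where s: "s \<in> S" "h = T s" by auto
  interpret group "GL_group scale" by (rule group_GL_group[OF vector_space])
  have "inv\<^bsub>GL_group scale\<^esub> h = h"
    using s transvection_in_GL_group[OF vector_space alternating] transvection_invol
    by (intro inv_equality) (auto simp: GL_group_def)
  then show ?case using s assms(3) by simp
next
  case (eng h1 h2)
  then have "P (h1 \<circ> h2)" using assms(4) by blast
  then show ?case by (simp add: GL_group_def comp_def)
qed

lemma orbit_iff: "\<gamma> \<in> orbit \<beta> \<longleftrightarrow> (\<exists>g\<in>\<Gamma>. \<gamma> = \<beta> \<circ> g)"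
  unfolding Gamma_dual_orbit_def Gamma_dual_def by (force simp: pullback_def)

lemma orbit_refl: "\<beta> \<in> orbit \<beta>"
  unfolding orbit_iff using id_in_Gamma by (metis comp_id)

lemma orbit_trans: "\<gamma> \<in> orbit \<beta> \<Longrightarrow> \<eta> \<in> orbit \<gamma> \<Longrightarrow> \<eta> \<in> orbit \<beta>"
  unfolding orbit_iff using Gamma_comp by (metis comp_assoc)

lemma dual_transvection:
  "Vector_Spaces.linear scale (*) \<alpha> \<Longrightarrow> \<alpha> \<circ> T x = (\<lambda>y. \<alpha> y + \<alpha> x * \<omega> x y)"
  by (auto simp: transvection_def dual_add dual_scale omega_commute mult.commute)

text \<open>Lifts the dual action to the free space; \<open>free_scale\<close> covers the values 0
  and 1 of \<open>\<delta> y x\<close> by one formula.\<close>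

lemma coboundary_transvection: "\<delta> y \<circ> T x = \<delta> (y + free_scale (\<delta> y x) (bd x))"
proof -
  have "free_scale (0::bit) z = 0" "free_scale (1::bit) z = z" for z :: "'v \<Rightarrow>\<^sub>0 bit"
    by (auto intro!: poly_mapping_eqI simp: lookup_free_scale)
  then show ?thesis
    unfolding dual_transvection[OF coboundary_linear]
    using bit_cases[of "\<delta> y x"] omega_eq_coboundary[of x] by (auto simp: coboundary_add)
qed

text \<open>Each generator changes a functional by an element of the image of
  \<open>\<omega>\<close>, and such changes add up. This is the necessity of the coset
  condition.\<close>

lemma Gamma_diff:
  assumes "g \<in> \<Gamma>" "Vector_Spaces.linear scale (*) \<alpha>"
  shows "\<exists>x. \<alpha> \<circ> g = (\<lambda>y. \<alpha> y + \<omega> x y)"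
proof -
  \<comment> \<open>Linearity of \<open>\<alpha> \<circ> g\<close> is carried along because, for a
    composition, the hypothesis on \<open>h\<close> is applied to
    \<open>\<alpha> \<circ> g\<close>.\<close>
  have "Vector_Spaces.linear scale (*) \<alpha> \<longrightarrow>
      Vector_Spaces.linear scale (*) (\<alpha> \<circ> g) \<and> (\<exists>x. \<alpha> \<circ> g = (\<lambda>y. \<alpha> y + \<omega> x y))" for \<alpha>
    using assms(1)
  proof (induction arbitrary: \<alpha> rule: Gamma_induct)
    case id
    have "\<alpha> = (\<lambda>y. \<alpha> y + \<omega> 0 y)" by (simp only: omega_simps add_0_right)
    then show ?case by (metis comp_id)
  next
    case (transvection s)
    have "Vector_Spaces.linear scale scale (T s)"
      using transvection_in_GL_group[OF vector_space alternating] by (simp add: GL_group_def)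
    moreover have "\<alpha> \<circ> T s = (\<lambda>y. \<alpha> y + \<omega> (scale (\<alpha> s) s) y)"
      if "Vector_Spaces.linear scale (*) \<alpha>"
      using that by (simp add: dual_transvection omega_simps)
    ultimately show ?case
      using Vector_Spaces.linear_compose by blast
  next
    case (comp g h)
    show ?case
    proof
      assume \<alpha>: "Vector_Spaces.linear scale (*) \<alpha>"
      obtain x where g: "Vector_Spaces.linear scale (*) (\<alpha> \<circ> g)" "\<alpha> \<circ> g = (\<lambda>y. \<alpha> y + \<omega> x y)"
        using comp(1) \<alpha> by blast
      obtain x' where h: "Vector_Spaces.linear scale (*) (\<alpha> \<circ> g \<circ> h)"
        "\<alpha> \<circ> g \<circ> h = (\<lambda>y. (\<alpha> \<circ> g) y + \<omega> x' y)"
        using comp(2) g(1) by blast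
      have "\<alpha> \<circ> (g \<circ> h) = (\<lambda>y. \<alpha> y + \<omega> (x + x') y)"
        using fun_cong[OF h(2)] fun_cong[OF g(2)]
        by (intro ext) (simp only: comp_apply omega_simps add.assoc)
      then show "Vector_Spaces.linear scale (*) (\<alpha> \<circ> (g \<circ> h))
          \<and> (\<exists>x. \<alpha> \<circ> (g \<circ> h) = (\<lambda>y. \<alpha> y + \<omega> x y))"
        using h(1) by (auto simp: comp_assoc)
    qed
  qed
  then show ?thesis using assms(2) by blast
qed

text \<open>A generator fixes \<open>y\<close> when the ends of its edge have equal coordinates and
  exchanges them otherwise, so the support size survives.\<close>

lemma Gamma_coboundary:
  assumes "g \<in> \<Gamma>" "y \<in> free_space V"
  shows "\<exists>z\<in>free_space V. \<delta> y \<circ> g = \<delta> z \<and> card (keys z) = card (keys y)"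
  using assms
proof (induction arbitrary: y rule: Gamma_induct)
  case id
  then show ?case by auto
next
  case (transvection s)
  obtain u v where uv: "u \<noteq> v" "u \<in> V" "v \<in> V" "bd s = vtx u + vtx v"
    using ends_pair[OF transvection(1)] by metis
  let ?z = "y + free_scale (\<delta> y s) (bd s)"
  have "?z \<in> free_space V"
    using transvection(2) boundary_in_free_space[of s]
    by (intro free_space_add) (auto simp: free_space_def in_keys_iff lookup_free_scale)
  moreover have "card (keys ?z) = card (keys y)"
  proof (cases "lookup y u = lookup y v")
    case True
    then have "?z = y"
      using uv by (intro poly_mapping_eqI)
        (simp add: coboundary_apply bit_add_self lookup_add lookup_free_scale)
    then show ?thesis by simp
  next
    case False
    then have "\<delta> y s = 1"
      using uv bit_cases[of "lookup y u"] bit_cases[of "lookup y v"] by (auto simp: coboundary_apply)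
    then have "?z = y + vtx u + vtx v"
      using uv by (intro poly_mapping_eqI) (simp add: lookup_add lookup_free_scale add.assoc)
    then show ?thesis
      using card_keys_exchange[OF False] by (simp add: add.assoc)
  qed
  ultimately show ?case
    using coboundary_transvection by blast
next
  case (comp g h)
  then show ?case by (metis comp_assoc)
qed

section \<open>Transvections joining two vertices\<close>

text \<open>Conjugating \<open>T y\<close> by \<open>T x\<close> gives the transvection along \<open>T x y = x + y\<close>.\<close>

lemma transvection_add_in_Gamma:
  assumes "T x \<in> \<Gamma>" "T y \<in> \<Gamma>" "\<omega> x y = 1"
  shows "T (x + y) \<in> \<Gamma>"
proof -
  have "\<omega> y x = 1"
    using assms(3) by (simp add: omega_commute)
  then have "T (x + y) = T x \<circ> T y \<circ> T x"
    using assms(3) add_self[of x]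
    by (intro ext) (auto simp: transvection_def omega_simps algebra_simps)
  then show ?thesis
    using assms Gamma_comp by metis
qed

text \<open>Here \<open>x\<close> imitates an edge that may be absent from \<open>M\<close>. Several
  such elements may exist, so the value \<open>b\<close> is related to \<open>u\<close> and
  \<open>v\<close> and not a function of them.\<close>

definition joins :: "('x \<Rightarrow> bit) \<Rightarrow> 'v \<Rightarrow> 'v \<Rightarrow> bit \<Rightarrow> bool" where
  "joins \<alpha> u v b \<longleftrightarrow> (\<exists>x. T x \<in> \<Gamma> \<and> bd x = vtx u + vtx v \<and> \<alpha> x = b)"

lemma joins_commute: "joins \<alpha> u v b \<Longrightarrow> joins \<alpha> v u b"
  by (auto simp: joins_def add.commute)

lemma joins_edge:
  assumes "e \<in> S" "ends M e = {u, v}"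
  shows "joins \<alpha> u v (\<alpha> e)"
proof -
  have "bd e = vtx u + vtx v"
    using ends_pair[OF assms(1)] assms(2) by (metis add.commute doubleton_eq_iff)
  then show ?thesis
    using transvection_in_Gamma[OF assms(1)] by (auto simp: joins_def)
qed

text \<open>For distinct vertices the two boundaries overlap in \<open>v\<close> alone, so
  \<open>\<omega> x y = 1\<close> and \<open>x + y\<close> again has its transvection in
  \<open>\<Gamma>\<close>.\<close>

lemma joins_trans:
  assumes "Vector_Spaces.linear scale (*) \<alpha>"
    and "joins \<alpha> u v b" "joins \<alpha> v w c" "u \<noteq> v" "v \<noteq> w" "u \<noteq> w"
  shows "joins \<alpha> u w (b + c)"
proof -
  obtain x y where x: "T x \<in> \<Gamma>" "bd x = vtx u + vtx v" "\<alpha> x = b"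
    and y: "T y \<in> \<Gamma>" "bd y = vtx v + vtx w" "\<alpha> y = c"
    using assms by (auto simp: joins_def)
  have "\<omega> x y = 1"
    unfolding omega_eq_coboundary using assms x y
    by (simp add: coboundary_apply lookup_add lookup_single when_def)
  moreover have "bd (x + y) = vtx u + vtx w"
    by (intro poly_mapping_eqI) (simp add: x y boundary_add lookup_add lookup_single when_def)
  moreover have "\<alpha> (x + y) = b + c"
    by (simp only: dual_add[OF assms(1)] x y)
  ultimately show ?thesis
    unfolding joins_def using transvection_add_in_Gamma[OF x(1) y(1)] by blast
qed

lemma joins_exists:
  assumes "Vector_Spaces.linear scale (*) \<alpha>" "u \<in> V" "v \<in> V" "u \<noteq> v"
  shows "\<exists>b. joins \<alpha> u v b"
proof -
  \<comment> \<open>The case \<open>u = v\<close> keeps the induction going when the path returns to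
    its start.\<close>
  have "u = v \<or> (\<exists>b. joins \<alpha> u v b)"
    using assms(2,3)
  proof (induction rule: vertex_induct)
    case (step e w w')
    have "w \<noteq> w'"
      using ends_pair[OF step(1)] step(2) by (metis doubleton_eq_iff)
    then show ?case
      using step joins_edge[OF step(1,2)] joins_trans[OF assms(1)] by metis
  qed simp
  then show ?thesis using assms(4) by blast
qed

text \<open>Were all elements joining the ends of an edge to have \<open>\<alpha>\<close>-value 0, the values of \<open>\<alpha>\<close> on
  elements joining \<open>u\<close> to \<open>w\<close> would depend on \<open>w\<close> only, and this potential would have co-boundary
  \<open>\<alpha>\<close>.\<close>

lemma joins_1_of_not_coboundary:
  assumes \<alpha>: "Vector_Spaces.linear scale (*) \<alpha>" "\<alpha> \<notin> \<delta> ` free_space V"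
    and uv: "u \<in> V" "v \<in> V" "u \<noteq> v"
  shows "joins \<alpha> u v 1"
proof (rule ccontr)
  assume no: "\<not> joins \<alpha> u v 1"
  note trans = joins_trans[OF \<alpha>(1)]
  have 0: "joins \<alpha> u v 0"
    using no joins_exists[OF \<alpha>(1) uv] bit_cases by metis
  have uniq: "b = c" if bc: "joins \<alpha> u w b" "joins \<alpha> u w c" and w: "w \<noteq> u" for w b c
  proof (rule ccontr)
    assume "b \<noteq> c"
    then have bc1: "b + c = 1"
      using bit_cases[of b] bit_cases[of c] by auto
    show False
    proof (cases "w = v")
      case True
      then show ?thesis using no bc \<open>b \<noteq> c\<close> bit_cases by metis
    next
      case False
      \<comment> \<open>The route \<open>v\<close>, \<open>u\<close>, \<open>w\<close> has value
        \<open>0 + c\<close>; following it back from \<open>w\<close> after going from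
        \<open>u\<close> to \<open>w\<close> gives the forbidden value
        \<open>b + c = 1\<close>.\<close>
      then have "joins \<alpha> v w c"
        using trans[OF joins_commute[OF 0] bc(2)] uv w by (metis add_0_left)
      then have "joins \<alpha> u v (b + c)"
        using trans[OF bc(1) joins_commute] uv w False by blast
      then show ?thesis using no bc1 by simp
    qed
  qed
  \<comment> \<open>The potential, normalised to 0 at \<open>u\<close>; elsewhere the description is
    justified by \<open>joins_exists\<close> and \<open>uniq\<close>.\<close>
  define p where "p w = (if w = u then 0 else THE b. joins \<alpha> u w b)" for w
  have p_u: "p u = 0"
    by (simp add: p_def)
  have p: "joins \<alpha> u w b \<longleftrightarrow> p w = b" if w: "w \<in> V" "w \<noteq> u" for w b
  proof -
    obtain c where "joins \<alpha> u w c"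
      using joins_exists[OF \<alpha>(1)] uv w by metis
    then have "(THE b. joins \<alpha> u w b) = c"
      using uniq w by blast
    then show ?thesis
      using \<open>joins \<alpha> u w c\<close> uniq w by (auto simp: p_def)
  qed
  have p_edge: "p w + p w' = \<alpha> e"
    if "e \<in> S" "ends M e = {w, w'}" "w \<noteq> w'" "w \<in> V" "w' \<in> V" for e w w'
  proof -
    \<comment> \<open>At least one end of an edge differs from \<open>u\<close>, so one of the two
      orientations satisfies \<open>b \<noteq> u\<close>.\<close>
    have *: "p a + p b = \<alpha> e" if "ends M e = {a, b}" "a \<noteq> b" "a \<in> V" "b \<in> V" "b \<noteq> u" for a b
    proof (cases "a = u")
      case True
      then have "joins \<alpha> u b (\<alpha> e)"
        using joins_edge[OF \<open>e \<in> S\<close>] that by blast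
      then show ?thesis
        using p p_u that True by simp
    next
      case False
      then have "joins \<alpha> u b (p a + \<alpha> e)"
        using trans[OF _ joins_edge[OF \<open>e \<in> S\<close>]] p that by blast
      then have "p b = p a + \<alpha> e"
        using p that by simp
      then show ?thesis
        by (simp only: add.assoc[symmetric] bit_add_self add_0_left)
    qed
    show ?thesis
      using *[of w w'] *[of w' w] that by (metis add.commute insert_commute)
  qed
  \<comment> \<open>The vector whose coordinates on \<open>V\<close> are the values of the
    potential.\<close>
  define y where "y = (\<Sum>w\<in>{w \<in> V. p w = 1}. vtx w)"
  have lookup_y: "lookup y w = (if w \<in> V then p w else 0)" for w
    unfolding y_def using finite_verts bit_cases[of "p w"] by (auto simp: lookup_sum_single)
  then have "y \<in> free_space V"
    by (auto simp: free_space_def in_keys_iff split: if_splits)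
  moreover have "\<delta> y = \<alpha>"
  proof (rule dual_eqI[OF coboundary_linear \<alpha>(1)])
    fix e assume e: "e \<in> S"
    then show "\<delta> y e = \<alpha> e"
      using ends_pair[OF e] p_edge[OF e] lookup_y by (metis coboundary_apply)
  qed
  ultimately show False using \<alpha>(2) by blast
qed

section \<open>Orbits outside the image of the co-boundary\<close>

lemma linear_add_omega:
  "Vector_Spaces.linear scale (*) \<alpha> \<Longrightarrow> Vector_Spaces.linear scale (*) (\<lambda>y. \<alpha> y + \<omega> x y)"
  using vector_space vector_space_bit
  by (intro Vector_Spaces.linear.intro)
    (auto simp: module_hom_iff vector_space_def module_def dual_add dual_scale omega_simps
      algebra_simps)

text \<open>The image of \<open>\<omega>\<close> lies in that of \<open>\<delta>\<close>, so adding
  \<open>\<omega> x\<close> cannot move a functional into the latter.\<close>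

lemma add_omega_not_coboundary:
  assumes "\<alpha> \<notin> \<delta> ` free_space V"
  shows "(\<lambda>y. \<alpha> y + \<omega> x y) \<notin> \<delta> ` free_space V"
proof
  assume "(\<lambda>y. \<alpha> y + \<omega> x y) \<in> \<delta> ` free_space V"
  then obtain z where z: "z \<in> free_space V" "(\<lambda>y. \<alpha> y + \<omega> x y) = \<delta> z" by auto
  have "\<alpha> y = \<delta> (z + bd x) y" for y
    unfolding coboundary_add omega_eq_coboundary[symmetric] fun_cong[OF z(2), of y, symmetric]
    by (simp only: add.assoc bit_add_self add_0_right)
  then show False
    using assms z(1) boundary_in_free_space free_space_add by blast
qed

text \<open>Expands \<open>x\<close> in the basis and adds one \<open>\<omega> e\<close> at a
  time.\<close>

lemma orbit_not_coboundary:
  assumes "Vector_Spaces.linear scale (*) \<beta>" "\<beta> \<notin> \<delta> ` free_space V"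
  shows "(\<lambda>y. \<beta> y + \<omega> x y) \<in> orbit \<beta>"
  using span_S[of x]
proof (induction x rule: span_induct_alt)
  case base
  then show ?case by (simp only: omega_simps add_0_right orbit_refl)
next
  case (step c e x)
  let ?\<alpha> = "\<lambda>y. \<beta> y + \<omega> x y"
  note lin = linear_add_omega[OF assms(1), of x]
  obtain u v where uv: "u \<noteq> v" "u \<in> V" "v \<in> V" "bd e = vtx u + vtx v"
    using ends_pair[OF step(1)] by metis
  \<comment> \<open>The functional may vanish at \<open>e\<close>, and then \<open>T e\<close> fixes
    it. An element with the same boundary and value 1 replaces \<open>e\<close>, since
    \<open>\<omega>\<close> sees only boundaries.\<close>
  obtain x' where x': "T x' \<in> \<Gamma>" "bd x' = vtx u + vtx v" "?\<alpha> x' = 1"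
    using joins_1_of_not_coboundary[OF lin add_omega_not_coboundary[OF assms(2)] uv(2,3,1)]
    by (auto simp: joins_def)
  have "\<omega> x' = \<omega> e"
    using x'(2) uv(4) by (simp only: omega_eq_coboundary)
  then have "?\<alpha> \<circ> T x' = (\<lambda>y. ?\<alpha> y + \<omega> e y)"
    unfolding dual_transvection[OF lin] x'(3) by (simp only: mult_1_left)
  then have e: "(\<lambda>y. ?\<alpha> y + \<omega> e y) \<in> orbit \<beta>"
    using orbit_trans[OF step(2)] x'(1) unfolding orbit_iff by metis
  show ?case
    using bit_cases[of c]
  proof
    assume "c = 0"
    then show ?thesis using step(2) by (simp only: scale_zero_left add_0_left)
  next
    assume "c = 1"
    then show ?thesis using e by (simp only: scale_one omega_simps ac_simps)
  qed
qed

section \<open>Orbits inside the image of the co-boundary\<close>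

text \<open>Each exchange moves a coordinate 1 of \<open>y\<close> from outside the support of
  \<open>z\<close> into it, which shrinks the difference of the supports.\<close>

lemma orbit_coboundary:
  assumes "y \<in> free_space V" "z \<in> free_space V" "card (keys y) = card (keys z)"
  shows "\<delta> z \<in> orbit (\<delta> y)"
  using assms
proof (induction "card (keys y - keys z)" arbitrary: y rule: less_induct)
  case less
  show ?case
  proof (cases "y = z")
    case True
    then show ?thesis by (simp add: orbit_refl)
  next
    case False
    have "keys y \<noteq> keys z"
      using False by (metis in_keys_bit_iff in_keys_iff poly_mapping_eqI)
    \<comment> \<open>Of two distinct finite sets of equal size, neither contains the other.\<close>
    then obtain u v where u: "u \<in> keys y" "u \<notin> keys z" and v: "v \<in> keys z" "v \<notin> keys y"
      using less(4) by (metis card_subset_eq finite_keys subsetI)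
    have uv: "u \<in> V" "v \<in> V" "u \<noteq> v"
      using u v less(2,3) by (auto simp: free_space_def)
    obtain x where x: "T x \<in> \<Gamma>" "bd x = vtx u + vtx v"
      using joins_exists[OF coboundary_linear uv] by (auto simp: joins_def)
    have look: "lookup y u = 1" "lookup y v = 0"
      using u v by (auto simp: in_keys_bit_iff in_keys_iff)
    let ?y = "y + vtx u + vtx v"
    have "\<delta> y x = 1"
      using x uv look by (simp add: coboundary_apply)
    then have "\<delta> y \<circ> T x = \<delta> ?y"
      unfolding coboundary_transvection using x
      by (intro arg_cong[of _ _ \<delta>] poly_mapping_eqI)
        (simp add: lookup_add lookup_free_scale add.assoc)
    then have "\<delta> ?y \<in> orbit (\<delta> y)"
      using x(1) unfolding orbit_iff by metis
    moreover have "\<delta> z \<in> orbit (\<delta> ?y)"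
    proof (rule less(1))
      have "keys ?y - keys z = (keys y - keys z) - {u}"
        using look u v
        by (auto simp: in_keys_bit_iff lookup_add lookup_single when_def bit_add_self
            split: if_splits)
      then show "card (keys ?y - keys z) < card (keys y - keys z)"
        using u card_Diff1_less[of "keys y - keys z" u] by simp
      show "?y \<in> free_space V"
        using less(2) uv by (intro free_space_add single_in_free_space)
      show "card (keys ?y) = card (keys z)"
        using card_keys_exchange[of y u v] look less(4) by simp
    qed (rule less(3))
    ultimately show ?thesis by (rule orbit_trans)
  qed
qed

text \<open>The group preserves support size, while \<open>\<delta>\<close> identifies a vector with
  its complement; \<open>d_min\<close> is the size up to this ambiguity.\<close>

lemma orbit_coboundary_iff:
  assumes "y \<in> free_space V" "z \<in> free_space V"
  shows "\<delta> z \<in> orbit (\<delta> y) \<longleftrightarrow> d_min V y = d_min V z"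
proof
  assume "\<delta> z \<in> orbit (\<delta> y)"
  then obtain w where w: "w \<in> free_space V" "\<delta> z = \<delta> w" "card (keys w) = card (keys y)"
    using Gamma_coboundary[OF _ assms(1)] unfolding orbit_iff by metis
  then have "d_min V w = d_min V y"
    using assms(1) finite_verts by (simp add: d_min_eq_card_keys free_space_def)
  then show "d_min V y = d_min V z"
    using d_min_eq_of_coboundary_eq[OF assms(2) w(1,2)] by simp
next
  assume eq: "d_min V y = d_min V z"
  have le: "card (keys y) \<le> card V" "card (keys z) \<le> card V"
    using assms finite_verts by (auto simp: free_space_def intro: card_mono)
  have "card (keys y) = card (keys z) \<or> card (keys y) = card V - card (keys z)"
    using eq assms finite_verts le
    by (auto simp: d_min_eq_card_keys free_space_def min_def split: if_splits)
  then show "\<delta> z \<in> orbit (\<delta> y)"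
  proof
    \<comment> \<open>Passing to \<open>z + ones\<close> equalises the support sizes without
      changing the co-boundary.\<close>
    assume "card (keys y) = card V - card (keys z)"
    then have "card (keys y) = card (keys (z + ones))"
      using assms finite_verts by (simp add: card_keys_add_ones free_space_def)
    then have "\<delta> (z + ones) \<in> orbit (\<delta> y)"
      using assms ones_in_free_space by (intro orbit_coboundary free_space_add)
    moreover have "\<delta> (z + ones) = \<delta> z"
      by (auto simp: coboundary_add coboundary_ones)
    ultimately show ?thesis by simp
  qed (use assms orbit_coboundary in blast)
qed

end

theorem theorem10p6:
  fixes scale :: "bit \<Rightarrow> 'x::ab_group_add \<Rightarrow> 'x"
    and Basis S :: "'x set"
    and \<omega> :: "'x \<Rightarrow> 'x \<Rightarrow> bit"
    and M :: "('v, 'x) multigraph"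
    and \<beta> \<gamma> :: "'x \<Rightarrow> bit"
  assumes "finite_dimensional_vector_space scale Basis"
    and "alternating_form scale \<omega>"
    and "is_basis scale S"
    and "\<not> orthogonal_type \<omega> S"
    and "connected_graph (form_graph \<omega> S)"
    and "is_multigraph M"
    and "connected_multigraph M"
    and "line_graph M = form_graph \<omega> S"
    and "\<beta> \<in> dual_space scale"
    and "\<gamma> \<in> dual_space scale"
  shows
    "(\<gamma> \<in> Gamma_dual_orbit scale \<omega> S \<beta> \<longleftrightarrow>
        (\<lambda>x. \<gamma> x - \<beta> x) \<in> range \<omega> \<and>
        (\<beta> \<notin> coboundary scale M ` free_space (mverts M) \<or>
         (\<beta> \<in> coboundary scale M ` free_space (mverts M) \<and>
          (\<exists>y\<in>free_space (mverts M). \<exists>z\<in>free_space (mverts M).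
             coboundary scale M y = \<beta> \<and> coboundary scale M z = \<gamma> \<and>
             d_min (mverts M) y = d_min (mverts M) z)))) \<and>
     (\<gamma> \<in> Gamma_dual_orbit scale \<omega> S \<beta> \<longleftrightarrow>
        (\<lambda>x. \<gamma> x - \<beta> x) \<in> range \<omega> \<and>
        (\<beta> \<notin> coboundary scale M ` free_space (mverts M) \<or>
         (\<beta> \<in> coboundary scale M ` free_space (mverts M) \<and>
          (\<forall>y\<in>free_space (mverts M). \<forall>z\<in>free_space (mverts M).
             coboundary scale M y = \<beta> \<and> coboundary scale M z = \<gamma> \<longrightarrow>
             d_min (mverts M) y = d_min (mverts M) z))))"
proof -
  interpret fd: finite_dimensional_vector_space scale Basis by fact
  interpret line_graph_form scale S \<omega> M
  proof
    show "finite S"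
      using assms(3) fd.finiteI_independent by (simp add: is_basis_def)
  qed (use assms fd.vector_space_axioms in auto)
  have lin: "Vector_Spaces.linear scale (*) \<beta>"
    using assms(9) by (simp add: dual_space_def)
  have diff: "\<gamma> = (\<lambda>y. \<beta> y + \<omega> x y)" if "(\<lambda>x. \<gamma> x - \<beta> x) = \<omega> x" for x
    using fun_cong[OF that] by (metis add.commute diff_add_cancel)
  have range: "(\<lambda>x. \<gamma> x - \<beta> x) \<in> range \<omega>" if "\<gamma> \<in> orbit \<beta>"
  proof -
    obtain g where g: "g \<in> \<Gamma>" "\<gamma> = \<beta> \<circ> g"
      using \<open>\<gamma> \<in> orbit \<beta>\<close> unfolding orbit_iff by blast
    obtain x where "\<gamma> = (\<lambda>y. \<beta> y + \<omega> x y)"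
      using Gamma_diff[OF g(1) lin] g(2) by blast
    then have "(\<lambda>x. \<gamma> x - \<beta> x) = \<omega> x"
      by (intro ext) (simp only: add_diff_cancel_left')
    then show ?thesis by simp
  qed
  show ?thesis
  proof (cases "\<beta> \<in> \<delta> ` free_space V")
    case False
    have "\<gamma> \<in> orbit \<beta>" if "(\<lambda>x. \<gamma> x - \<beta> x) \<in> range \<omega>"
      using that
    proof (rule rangeE)
      fix x assume "(\<lambda>x. \<gamma> x - \<beta> x) = \<omega> x"
      then show ?thesis using diff orbit_not_coboundary[OF lin False, of x] by metis
    qed
    then show ?thesis
      using False range by blast
  next
    case True
    then obtain y where y: "y \<in> free_space V" "\<delta> y = \<beta>" by blast
    \<comment> \<open>As \<open>\<omega> x = \<delta> (bd x)\<close>, a preimage of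
      \<open>\<beta>\<close> yields one of \<open>\<gamma>\<close>; hence the version with any
      \<open>y\<close> and \<open>z\<close> is not vacuous.\<close>
    have lift: "\<exists>z\<in>free_space V. \<delta> z = \<gamma>" if im: "(\<lambda>x. \<gamma> x - \<beta> x) \<in> range \<omega>"
    proof -
      obtain x where "\<gamma> = (\<lambda>y. \<beta> y + \<omega> x y)"
        using im diff by (elim rangeE) blast
      then have "\<gamma> = \<delta> (y + bd x)"
        using y by (intro ext) (simp only: coboundary_add omega_eq_coboundary)
      then show ?thesis
        using y boundary_in_free_space free_space_add by blast
    qed
    \<comment> \<open>Orbit membership does not mention the preimages, so the versions with some and
      with any preimages both follow.\<close>
    have eq: "\<gamma> \<in> orbit \<beta> \<longleftrightarrow> d_min V y' = d_min V z"
      if "y' \<in> free_space V" "z \<in> free_space V" "\<delta> y' = \<beta>" "\<delta> z = \<gamma>" for y' z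
      using orbit_coboundary_iff[OF that(1,2)] that(3,4) by simp
    show ?thesis
    proof (cases "(\<lambda>x. \<gamma> x - \<beta> x) \<in> range \<omega>")
      case im: True
      obtain z where z: "z \<in> free_space V" "\<delta> z = \<gamma>"
        using lift[OF im] by blast
      have ex: "\<gamma> \<in> orbit \<beta> \<longleftrightarrow> (\<exists>y\<in>free_space V. \<exists>z\<in>free_space V.
          \<delta> y = \<beta> \<and> \<delta> z = \<gamma> \<and> d_min V y = d_min V z)"
        using eq y z by blast
      have all: "\<gamma> \<in> orbit \<beta> \<longleftrightarrow> (\<forall>y\<in>free_space V. \<forall>z\<in>free_space V.
          \<delta> y = \<beta> \<and> \<delta> z = \<gamma> \<longrightarrow> d_min V y = d_min V z)"
        using eq y z by blast
      from True im show ?thesis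
        by (intro conjI) (simp_all only: ex[symmetric] all[symmetric] simp_thms)
    next
      case False
      with range have "\<gamma> \<notin> orbit \<beta>" by blast
      with False show ?thesis by (simp only: simp_thms)
    qed
  qed
qed

end
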